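(* HyperQCTL$^*$ and MSO$[E]$ are expressively equivalent: for every HyperQCTL$^*$ formula over $AP$ there is an MSO$[E]$ sentence satisfied by exactly the same $AP$-labeled trees, and vice versa.
   Context: A tree is a partially ordered infinite set of nodes $S$ with a least element (root) such that each node's ancestors are totally ordered; $s'$ is the direct ancestor of $s$ if $s'<s$ with nothing strictly between. An $AP$-labeled tree has $L:S\to2^{AP}$. A path is an infinite sequence $s_0s_1\dots$ with $s_i$ the direct ancestor of $s_{i+1}$; $Paths(\mathcal T)$ are the paths from the root; $p[0,i]$ is the prefix up to $i$. HyperCTL$^*$ syntax: $\varphi ::= a_\pi\mid\neg\varphi\mid\varphi\vee\varphi\mid\mathsf X\varphi\mid\varphi\mathsf U\varphi\mid\exists\pi.\varphi$, semantics under a path assignment $\Pi$ and position $i$: $a_\pi$ holds iff $a\in L(\Pi(\pi)[i])$; Boolean, $\mathsf X$, $\mathsf U$ as in LTL over positions; $\Pi,i\models\exists\pi.\varphi$ iff some $p\in Paths(\mathcal T)$ with $p[0,i]=\Pi(\varepsilon)[0,i]$ ($\varepsilon$ the most recently quantified path; no constraint if none) satisfies $\Pi[\pi\mapsto p,\varepsilon\mapsto p],i\models\varphi$. HyperQCTL$^*$ extends HyperCTL$^*$ with atoms $q_\pi$ and propositional quantification $\exists q.\varphi$ (and dual $\forall q$): $\Pi,i\models_{\mathcal T}\exists q.\varphi$ iff there is a labeling $L':S\to2^{AP\cup\{q\}}$ agreeing with $L$ on $AP\setminus\{q\}$ at every node such that $\Pi,i\models\varphi$ in the tree relabeled by $L'$.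 $\mathcal T\models\varphi$ iff $\emptyset,0\models_{\mathcal T}\varphi$. MSO$[E]$: monadic second-order formulas from $P_a(x)$, $x<y$, $x=y$, $E(x,y)$, $x\in X$ with $\neg,\vee,\exists x,\exists X$ over an $AP$-labeled tree: first-order variables range over nodes, second-order variables over arbitrary sets of nodes, $P_a(x)$ iff $a\in L(x)$, $x<y$ iff $x$ is an ancestor of $y$, $E(x,y)$ iff $x,y$ have the same number of ancestors.
   Formalization: From MSO[E] to HyperQCTL*, only trees whose every node lies on an infinite path from the root are covered (false otherwise: an extra leaf is invisible to HyperQCTL* ). The translated formula is given per type of nodes; one for all trees follows, as there is only a set of formulas. *)

theory Defs
  imports Main "HOL-Library.Equipollence"
begin

section \<open>Labeled trees\<close>

record ('s, 'p) ltree =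
  nodes :: "'s set"
  anc :: "'s \<Rightarrow> 's \<Rightarrow> bool"
  label :: "'s \<Rightarrow> 'p set"

definition ancestors :: "('s, 'p) ltree \<Rightarrow> 's \<Rightarrow> 's set" where
  "ancestors T s = {s' \<in> nodes T. anc T s' s}"

definition is_root :: "('s, 'p) ltree \<Rightarrow> 's \<Rightarrow> bool" where
  "is_root T r \<longleftrightarrow> r \<in> nodes T \<and> (\<forall>s \<in> nodes T. s \<noteq> r \<longrightarrow> anc T r s)"

text \<open>The relation \<open>anc\<close> is the strict part of the tree order; only its restriction to
  \<open>nodes\<close> matters. Nodes without children and nodes with infinitely many ancestors are allowed.\<close>

definition is_tree :: "('s, 'p) ltree \<Rightarrow> bool" where
  "is_tree T \<longleftrightarrow>
     infinite (nodes T) \<and>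
     irreflp_on (nodes T) (anc T) \<and> transp_on (nodes T) (anc T) \<and>
     (\<exists>r. is_root T r) \<and>
     (\<forall>s \<in> nodes T. totalp_on (ancestors T s) (anc T))"

definition labeled_tree :: "'p set \<Rightarrow> ('s, 'p) ltree \<Rightarrow> bool" where
  "labeled_tree AP T \<longleftrightarrow> is_tree T \<and> (\<forall>s \<in> nodes T. label T s \<subseteq> AP)"

definition direct_anc :: "('s, 'p) ltree \<Rightarrow> 's \<Rightarrow> 's \<Rightarrow> bool" where
  "direct_anc T s' s \<longleftrightarrow>
     s' \<in> nodes T \<and> s \<in> nodes T \<and> anc T s' s \<and>
     \<not> (\<exists>t \<in> nodes T. anc T s' t \<and> anc T t s)"

definition paths :: "('s, 'p) ltree \<Rightarrow> (nat \<Rightarrow> 's) set" where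
  "paths T = {p. is_root T (p 0) \<and> (\<forall>i. direct_anc T (p i) (p (Suc i)))}"

text \<open>Temporal formulas only ever inspect nodes on infinite paths from the root, whereas monadic
  second-order formulas inspect all nodes. For instance, a single infinite branch, and the same
  branch with one additional leaf attached to the root, satisfy the same HyperQCTL* sentences
  (for equal labels on the branch), but are told apart by the MSO[E] sentence ``some two distinct
  nodes are on the same level''. The following condition excludes such unreachable nodes; it holds
  for all trees obtained by unrolling a transition system with a total transition relation.\<close>

definition covered_by_paths :: "('s, 'p) ltree \<Rightarrow> bool" where
  "covered_by_paths T \<longleftrightarrow> (\<forall>s \<in> nodes T. \<exists>p \<in> paths T. s \<in> range p)"


section \<open>HyperQCTL*\<close>

text \<open>Atomic propositions and quantified propositions are drawn from the same type \<open>'p\<close>.\<close>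

datatype 'p hqctl =
    HAtom 'p nat
  | HNot "'p hqctl"
  | HOr "'p hqctl" "'p hqctl"
  | HNext "'p hqctl"
  | HUntil "'p hqctl" "'p hqctl"
  | HExPath nat "'p hqctl"
  | HExProp 'p "'p hqctl"

primrec free_paths :: "'p hqctl \<Rightarrow> nat set" where
  "free_paths (HAtom a \<pi>) = {\<pi>}"
| "free_paths (HNot \<phi>) = free_paths \<phi>"
| "free_paths (HOr \<phi> \<psi>) = free_paths \<phi> \<union> free_paths \<psi>"
| "free_paths (HNext \<phi>) = free_paths \<phi>"
| "free_paths (HUntil \<phi> \<psi>) = free_paths \<phi> \<union> free_paths \<psi>"
| "free_paths (HExPath \<pi> \<phi>) = free_paths \<phi> - {\<pi>}"
| "free_paths (HExProp q \<phi>) = free_paths \<phi>"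

primrec free_props :: "'p hqctl \<Rightarrow> 'p set" where
  "free_props (HAtom a \<pi>) = {a}"
| "free_props (HNot \<phi>) = free_props \<phi>"
| "free_props (HOr \<phi> \<psi>) = free_props \<phi> \<union> free_props \<psi>"
| "free_props (HNext \<phi>) = free_props \<phi>"
| "free_props (HUntil \<phi> \<psi>) = free_props \<phi> \<union> free_props \<psi>"
| "free_props (HExPath \<pi> \<phi>) = free_props \<phi>"
| "free_props (HExProp q \<phi>) = free_props \<phi> - {q}"

definition hqctl_formula_over :: "'p set \<Rightarrow> 'p hqctl \<Rightarrow> bool" where
  "hqctl_formula_over AP \<phi> \<longleftrightarrow> free_paths \<phi> = {} \<and> free_props \<phi> \<subseteq> AP"

text \<open>The argument \<open>e\<close> is the value of the path assignment at \<open>\<epsilon>\<close>, the most recently quantified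
  path. The set \<open>AP\<close> is the one over which the current tree is labeled; it grows under
  propositional quantification. The value of an atom at an unassigned path variable is irrelevant
  for formulas without free path variables.\<close>

primrec hqctl_sat ::
  "'p set \<Rightarrow> ('s, 'p) ltree \<Rightarrow> (nat \<rightharpoonup> (nat \<Rightarrow> 's)) \<Rightarrow> (nat \<Rightarrow> 's) option \<Rightarrow> nat \<Rightarrow> 'p hqctl \<Rightarrow> bool"
where
  "hqctl_sat AP T \<sigma> e i (HAtom a \<pi>) =
     (case \<sigma> \<pi> of None \<Rightarrow> False | Some p \<Rightarrow> a \<in> label T (p i))"
| "hqctl_sat AP T \<sigma> e i (HNot \<phi>) = (\<not> hqctl_sat AP T \<sigma> e i \<phi>)"
| "hqctl_sat AP T \<sigma> e i (HOr \<phi> \<psi>) = (hqctl_sat AP T \<sigma> e i \<phi> \<or> hqctl_sat AP T \<sigma> e i \<psi>)"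
| "hqctl_sat AP T \<sigma> e i (HNext \<phi>) = hqctl_sat AP T \<sigma> e (Suc i) \<phi>"
| "hqctl_sat AP T \<sigma> e i (HUntil \<phi> \<psi>) =
     (\<exists>j\<ge>i. hqctl_sat AP T \<sigma> e j \<psi> \<and> (\<forall>k\<in>{i..<j}. hqctl_sat AP T \<sigma> e k \<phi>))"
| "hqctl_sat AP T \<sigma> e i (HExPath \<pi> \<phi>) =
     (\<exists>p \<in> paths T. (\<forall>p'. e = Some p' \<longrightarrow> (\<forall>k\<le>i. p k = p' k)) \<and>
        hqctl_sat AP T (\<sigma>(\<pi> \<mapsto> p)) (Some p) i \<phi>)"
| "hqctl_sat AP T \<sigma> e i (HExProp q \<phi>) =
     (\<exists>L'. (\<forall>s \<in> nodes T. L' s \<subseteq> AP \<union> {q} \<and> L' s \<inter> (AP - {q}) = label T s \<inter> (AP - {q})) \<and>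
        hqctl_sat (AP \<union> {q}) (T\<lparr>label := L'\<rparr>) \<sigma> e i \<phi>)"

definition hqctl_models :: "'p set \<Rightarrow> ('s, 'p) ltree \<Rightarrow> 'p hqctl \<Rightarrow> bool" where
  "hqctl_models AP T \<phi> \<longleftrightarrow> hqctl_sat AP T Map.empty None 0 \<phi>"


section \<open>Monadic second-order logic with the equal-level predicate\<close>

datatype 'p mso =
    MPred 'p nat
  | MLess nat nat
  | MEq nat nat
  | MLevel nat nat
  | MIn nat nat
  | MNot "'p mso"
  | MOr "'p mso" "'p mso"
  | MExNode nat "'p mso"
  | MExSet nat "'p mso"

primrec mso_free_nodes :: "'p mso \<Rightarrow> nat set" where
  "mso_free_nodes (MPred a x) = {x}"
| "mso_free_nodes (MLess x y) = {x, y}"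
| "mso_free_nodes (MEq x y) = {x, y}"
| "mso_free_nodes (MLevel x y) = {x, y}"
| "mso_free_nodes (MIn x X) = {x}"
| "mso_free_nodes (MNot \<phi>) = mso_free_nodes \<phi>"
| "mso_free_nodes (MOr \<phi> \<psi>) = mso_free_nodes \<phi> \<union> mso_free_nodes \<psi>"
| "mso_free_nodes (MExNode x \<phi>) = mso_free_nodes \<phi> - {x}"
| "mso_free_nodes (MExSet X \<phi>) = mso_free_nodes \<phi>"

primrec mso_free_sets :: "'p mso \<Rightarrow> nat set" where
  "mso_free_sets (MPred a x) = {}"
| "mso_free_sets (MLess x y) = {}"
| "mso_free_sets (MEq x y) = {}"
| "mso_free_sets (MLevel x y) = {}"
| "mso_free_sets (MIn x X) = {X}"
| "mso_free_sets (MNot \<phi>) = mso_free_sets \<phi>"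
| "mso_free_sets (MOr \<phi> \<psi>) = mso_free_sets \<phi> \<union> mso_free_sets \<psi>"
| "mso_free_sets (MExNode x \<phi>) = mso_free_sets \<phi>"
| "mso_free_sets (MExSet X \<phi>) = mso_free_sets \<phi> - {X}"

primrec mso_props :: "'p mso \<Rightarrow> 'p set" where
  "mso_props (MPred a x) = {a}"
| "mso_props (MLess x y) = {}"
| "mso_props (MEq x y) = {}"
| "mso_props (MLevel x y) = {}"
| "mso_props (MIn x X) = {}"
| "mso_props (MNot \<phi>) = mso_props \<phi>"
| "mso_props (MOr \<phi> \<psi>) = mso_props \<phi> \<union> mso_props \<psi>"
| "mso_props (MExNode x \<phi>) = mso_props \<phi>"
| "mso_props (MExSet X \<phi>) = mso_props \<phi>"

definition mso_sentence_over :: "'p set \<Rightarrow> 'p mso \<Rightarrow> bool" where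
  "mso_sentence_over AP \<psi> \<longleftrightarrow>
     mso_free_nodes \<psi> = {} \<and> mso_free_sets \<psi> = {} \<and> mso_props \<psi> \<subseteq> AP"

text \<open>Equal numbers of ancestors are expressed by equipollence rather than by \<open>card\<close>, since the
  latter would identify nodes having infinitely many ancestors with the root.\<close>

primrec mso_sat ::
  "('s, 'p) ltree \<Rightarrow> (nat \<Rightarrow> 's) \<Rightarrow> (nat \<Rightarrow> 's set) \<Rightarrow> 'p mso \<Rightarrow> bool"
where
  "mso_sat T v V (MPred a x) = (a \<in> label T (v x))"
| "mso_sat T v V (MLess x y) = anc T (v x) (v y)"
| "mso_sat T v V (MEq x y) = (v x = v y)"
| "mso_sat T v V (MLevel x y) = (ancestors T (v x) \<approx> ancestors T (v y))"
| "mso_sat T v V (MIn x X) = (v x \<in> V X)"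
| "mso_sat T v V (MNot \<phi>) = (\<not> mso_sat T v V \<phi>)"
| "mso_sat T v V (MOr \<phi> \<psi>) = (mso_sat T v V \<phi> \<or> mso_sat T v V \<psi>)"
| "mso_sat T v V (MExNode x \<phi>) = (\<exists>s \<in> nodes T. mso_sat T (v(x := s)) V \<phi>)"
| "mso_sat T v V (MExSet X \<phi>) = (\<exists>A. A \<subseteq> nodes T \<and> mso_sat T v (V(X := A)) \<phi>)"

definition mso_models :: "('s, 'p) ltree \<Rightarrow> 'p mso \<Rightarrow> bool" where
  "mso_models T \<psi> \<longleftrightarrow>
     (\<forall>v V. (\<forall>x. v x \<in> nodes T) \<and> (\<forall>X. V X \<subseteq> nodes T) \<longrightarrow> mso_sat T v V \<psi>)"

end

theory Submission
  imports Defs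
begin

text \<open>From HyperQCTL* to MSO[E]: a path is represented by its range, a quantified proposition by
  the set of nodes carrying it, and a position \<open>i\<close> by the \<open>i\<close>-th node of one fixed path, the clock.
  The node of another path at the current position is found with the equal-level predicate. On a
  tree without paths there is no clock, but there the truth value of a formula depends on
  its syntax only.

  From MSO[E] to HyperQCTL*: every variable becomes a quantified proposition, a node variable one
  that labels a single node. All formulas are evaluated at position \<open>0\<close>, where path quantification
  is unconstrained because all paths start at the root; in a tree covered by its paths,
  \<open>\<exists>\<pi>. F\<close> then ranges over all nodes.\<close>

section \<open>Paths of a tree\<close>

lemma label_update_simps [simp]:
  "ancestors (T\<lparr>label := L\<rparr>) = ancestors T"
  "is_root (T\<lparr>label := L\<rparr>) = is_root T"
  "direct_anc (T\<lparr>label := L\<rparr>) = direct_anc T"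
  "paths (T\<lparr>label := L\<rparr>) = paths T"
  by (auto simp: fun_eq_iff ancestors_def is_root_def direct_anc_def paths_def)

lemma path_in_nodes: "p \<in> paths T \<Longrightarrow> p i \<in> nodes T"
  by (auto simp: paths_def direct_anc_def)

lemma path_root: "p \<in> paths T \<Longrightarrow> is_root T (p 0)"
  by (simp add: paths_def)

lemma path_step: "p \<in> paths T \<Longrightarrow> direct_anc T (p i) (p (Suc i))"
  by (simp add: paths_def)

section \<open>Order and levels along a path\<close>

context
  fixes T :: "('s, 'p) ltree"
  assumes tree: "is_tree T"
begin

lemma anc_irrefl: "s \<in> nodes T \<Longrightarrow> \<not> anc T s s"
  using tree unfolding is_tree_def by (blast dest: irreflp_onD)

lemma anc_trans:
  "anc T s t \<Longrightarrow> anc T t u \<Longrightarrow> s \<in> nodes T \<Longrightarrow> t \<in> nodes T \<Longrightarrow> u \<in> nodes T \<Longrightarrow> anc T s u"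
  using tree unfolding is_tree_def by (blast dest: transp_onD)

lemma anc_linear:
  "anc T s u \<Longrightarrow> anc T t u \<Longrightarrow> s \<in> nodes T \<Longrightarrow> t \<in> nodes T \<Longrightarrow> u \<in> nodes T \<Longrightarrow>
    s = t \<or> anc T s t \<or> anc T t s"
  using tree totalp_onD[of "ancestors T u" "anc T" s t]
  unfolding is_tree_def by (simp add: ancestors_def) blast

lemma nodes_nonempty: "nodes T \<noteq> {}"
  using tree by (auto simp: is_tree_def)

lemma root_unique: "is_root T r \<Longrightarrow> is_root T r' \<Longrightarrow> r = r'"
  unfolding is_root_def using anc_irrefl[of r] anc_trans[of r r' r] by metis

lemma path_less_imp_anc:
  assumes p: "p \<in> paths T" and "i < j"
  shows "anc T (p i) (p j)"
  using \<open>i < j\<close>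
proof (induction j)
  case (Suc j)
  have "anc T (p j) (p (Suc j))"
    using path_step[OF p] by (auto simp: direct_anc_def)
  then show ?case
    using Suc anc_trans[of "p i" "p j" "p (Suc j)"] path_in_nodes[OF p]
    by (auto simp: less_Suc_eq)
qed simp

lemma path_anc_iff:
  assumes p: "p \<in> paths T"
  shows "anc T (p i) (p j) \<longleftrightarrow> i < j"
  using path_less_imp_anc[OF p, of i j] path_less_imp_anc[OF p, of j i]
    anc_irrefl[of "p i"] anc_trans[of "p i" "p j" "p i"] path_in_nodes[OF p]
  by (cases i j rule: linorder_cases) auto

lemma path_eq_iff:
  assumes p: "p \<in> paths T"
  shows "p i = p j \<longleftrightarrow> i = j"
  using path_anc_iff[OF p, of i j] path_anc_iff[OF p, of j i] anc_irrefl[of "p i"]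
    path_in_nodes[OF p]
  by (cases i j rule: linorder_cases) auto

lemma inj_path: "p \<in> paths T \<Longrightarrow> inj p"
  by (simp add: inj_on_def path_eq_iff)

lemma path_direct_anc_iff:
  assumes p: "p \<in> paths T"
  shows "direct_anc T (p i) (p j) \<longleftrightarrow> j = Suc i"
proof
  assume d: "direct_anc T (p i) (p j)"
  then have "i < j" by (auto simp: direct_anc_def path_anc_iff[OF p])
  moreover have "\<not> Suc i < j"
    using d path_in_nodes[OF p, of "Suc i"] by (auto simp: direct_anc_def path_anc_iff[OF p])
  ultimately show "j = Suc i" by simp
qed (simp add: path_step p)

text \<open>By linearity an ancestor of \<open>p (Suc i)\<close> is comparable with
  \<open>p i\<close>, and it cannot lie strictly between the two, so each step adds exactly
  \<open>p i\<close>. In particular, nodes on paths have finitely many ancestors.\<close>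

lemma ancestors_path:
  assumes p: "p \<in> paths T"
  shows "ancestors T (p i) = p ` {..<i}"
proof (induction i)
  case 0
  have "\<not> anc T s (p 0)" if "s \<in> nodes T" for s
    using that path_root[OF p] anc_irrefl[of s] anc_trans[of s "p 0" s] unfolding is_root_def by metis
  then show ?case by (auto simp: ancestors_def)
next
  case (Suc i)
  have "anc T s (p (Suc i)) \<longleftrightarrow> s = p i \<or> anc T s (p i)" if s: "s \<in> nodes T" for s
  proof
    assume a: "anc T s (p (Suc i))"
    have d: "direct_anc T (p i) (p (Suc i))" by (rule path_step[OF p])
    then have "\<not> anc T (p i) s" using a s by (auto simp: direct_anc_def)
    then show "s = p i \<or> anc T s (p i)"
      using anc_linear[OF a, of "p i"] d s path_in_nodes[OF p] by (auto simp: direct_anc_def)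
  next
    assume "s = p i \<or> anc T s (p i)"
    then show "anc T s (p (Suc i))"
      using s anc_trans[of s "p i" "p (Suc i)"] path_in_nodes[OF p]
        path_less_imp_anc[OF p, of i "Suc i"] by auto
  qed
  then have "ancestors T (p (Suc i)) = insert (p i) (ancestors T (p i))"
    using path_in_nodes[OF p] by (auto simp: ancestors_def)
  then show ?case using Suc by (simp add: lessThan_Suc)
qed

text \<open>Both ancestor sets are injective images of initial segments of the naturals, so
  equipollence reduces to equality of their finite cardinalities. This lets the level predicate
  synchronize positions on different paths.\<close>

lemma path_level_iff:
  assumes p: "p \<in> paths T" and p': "p' \<in> paths T"
  shows "ancestors T (p i) \<approx> ancestors T (p' j) \<longleftrightarrow> i = j"
proof -
  have "card (p ` {..<i}) = i" "card (p' ` {..<j}) = j"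
    using inj_path[OF p] inj_path[OF p'] by (auto simp: card_image inj_on_subset)
  then show ?thesis
    by (simp add: ancestors_path[OF p] ancestors_path[OF p'] eqpoll_iff_card)
qed

lemma paths_meet_imp_eq_index:
  "p \<in> paths T \<Longrightarrow> p' \<in> paths T \<Longrightarrow> p i = p' j \<Longrightarrow> i = j"
  using path_level_iff[of p p' i j] by simp

text \<open>A node determines its ancestors, hence the path leading to it; the branching condition
  of path quantification thus concerns a single node.\<close>

lemma path_prefix_iff:
  assumes p: "p \<in> paths T" and p': "p' \<in> paths T"
  shows "(\<forall>k\<le>i. p k = p' k) \<longleftrightarrow> p i = p' i"
proof (safe)
  fix k assume eq: "p i = p' i" and "k \<le> i"
  show "p k = p' k"
  proof (cases "k = i")
    case False
    \<comment> \<open>\<open>p k\<close> is an ancestor of the shared node and so occurs on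
      \<open>p'\<close>; levels force its index there to be \<open>k\<close>.\<close>
    then have "p k \<in> ancestors T (p' i)"
      using \<open>k \<le> i\<close> eq[symmetric] by (simp add: ancestors_path[OF p])
    then obtain l where "p k = p' l"
      by (auto simp: ancestors_path[OF p'])
    then show ?thesis using paths_meet_imp_eq_index[OF p p', of k l] by simp
  qed (simp add: eq)
qed simp

end

section \<open>Path ranges as minimal serial sets\<close>

definition serial_set :: "('s, 'p) ltree \<Rightarrow> 's set \<Rightarrow> bool" where
  "serial_set T X \<longleftrightarrow> (\<exists>r\<in>X. is_root T r) \<and> (\<forall>s\<in>X. \<exists>t\<in>X. direct_anc T s t)"

lemma serial_set_range: "p \<in> paths T \<Longrightarrow> serial_set T (range p)"
  unfolding serial_set_def by (auto intro: path_root path_step)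

text \<open>Dependent choice: a child function on \<open>X\<close> is iterated from the
  root.\<close>

lemma serial_set_includes_path:
  assumes "serial_set T X"
  obtains p where "p \<in> paths T" "range p \<subseteq> X"
proof -
  obtain r where r: "r \<in> X" "is_root T r" and "\<forall>s\<in>X. \<exists>t\<in>X. direct_anc T s t"
    using assms by (auto simp: serial_set_def)
  then obtain c where c: "\<And>s. s \<in> X \<Longrightarrow> c s \<in> X \<and> direct_anc T s (c s)"
    by metis
  define p where "p i = (c ^^ i) r" for i
  have "p i \<in> X" for i
    unfolding p_def by (induction i) (use r c in auto)
  moreover from this c r have "p \<in> paths T"
    by (auto simp: paths_def p_def)
  ultimately show thesis using that by blast
qed

text \<open>The right-hand side quantifies over nodes and sets only, so it can be written in MSO. A
  serial subset of \<open>range p\<close> has to follow \<open>p\<close> step by step; conversely,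
  every serial set includes the range of a path, which is itself serial, and minimality gives
  equality.\<close>

lemma path_range_iff_minimal:
  assumes "is_tree T"
  shows "(\<exists>p\<in>paths T. X = range p) \<longleftrightarrow>
    serial_set T X \<and> (\<forall>Y. Y \<subseteq> X \<and> serial_set T Y \<longrightarrow> X \<subseteq> Y)" (is "?L \<longleftrightarrow> ?R")
proof
  assume ?L
  then obtain p where p: "p \<in> paths T" and X: "X = range p" by auto
  have "p i \<in> Y" if Y: "Y \<subseteq> X" "serial_set T Y" for Y i
  proof (induction i)
    case 0
    then show ?case
      using Y path_root[OF p] root_unique[OF assms] by (metis serial_set_def)
  next
    case (Suc i)
    then obtain t where t: "t \<in> Y" "direct_anc T (p i) t"
      using Y by (auto simp: serial_set_def)
    \<comment> \<open>The child found in \<open>Y\<close> lies on \<open>p\<close>, where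
      \<open>p i\<close> has no child but \<open>p (Suc i)\<close>.\<close>
    then obtain j where "t = p j" using Y X by auto
    then show ?case using t path_direct_anc_iff[OF assms p] by auto
  qed
  then show ?R using serial_set_range[OF p] X by blast
next
  assume R: ?R
  then obtain p where p: "p \<in> paths T" "range p \<subseteq> X"
    using serial_set_includes_path by blast
  then have "X = range p" using R serial_set_range by blast
  then show ?L using p by blast
qed


section \<open>Propositional quantification as set quantification\<close>

text \<open>Both translations treat \<open>HExProp\<close> through this lemma. By
  \<open>step\<close>, the truth of the body depends on the new labeling only through the extension
  of \<open>q\<close>, so guessing a labeling amounts to guessing that set.\<close>

lemma hqctl_sat_HExProp_iff:
  assumes L: "\<forall>s\<in>nodes T. L s \<subseteq> AP"
    and step: "\<And>L'. \<forall>s\<in>nodes T. L' s \<subseteq> insert q AP \<Longrightarrow>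
      \<forall>s\<in>nodes T. \<forall>a. a \<noteq> q \<longrightarrow> (a \<in> L' s \<longleftrightarrow> a \<in> L s) \<Longrightarrow>
      hqctl_sat (insert q AP) (T\<lparr>label := L'\<rparr>) \<sigma> e i \<phi> \<longleftrightarrow> P {s \<in> nodes T. q \<in> L' s}"
  shows "hqctl_sat AP (T\<lparr>label := L\<rparr>) \<sigma> e i (HExProp q \<phi>) \<longleftrightarrow> (\<exists>A\<subseteq>nodes T. P A)"
proof
  assume "hqctl_sat AP (T\<lparr>label := L\<rparr>) \<sigma> e i (HExProp q \<phi>)"
  then obtain L' where L': "\<forall>s\<in>nodes T. L' s \<subseteq> insert q AP \<and> L' s \<inter> (AP - {q}) = L s \<inter> (AP - {q})"
    and sat: "hqctl_sat (insert q AP) (T\<lparr>label := L'\<rparr>) \<sigma> e i \<phi>"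
    by auto
  \<comment> \<open>The semantics demands agreement on \<open>AP - {q}\<close> only; outside
    \<open>insert q AP\<close> neither labeling contains anything.\<close>
  have "\<forall>s\<in>nodes T. \<forall>a. a \<noteq> q \<longrightarrow> (a \<in> L' s \<longleftrightarrow> a \<in> L s)"
    using L L' by blast
  with step[of L'] L' sat have "P {s \<in> nodes T. q \<in> L' s}" by simp
  then show "\<exists>A\<subseteq>nodes T. P A" by (intro exI[of _ "{s \<in> nodes T. q \<in> L' s}"]) simp
next
  assume "\<exists>A\<subseteq>nodes T. P A"
  then obtain A where A: "A \<subseteq> nodes T" "P A" by blast
  \<comment> \<open>\<open>q\<close> may already occur in \<open>L\<close>, so it has to be removed
    outside \<open>A\<close>.\<close>
  define L' where "L' s = (if s \<in> A then insert q (L s) else L s - {q})" for s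
  have L': "\<forall>s\<in>nodes T. L' s \<subseteq> insert q AP \<and> L' s \<inter> (AP - {q}) = L s \<inter> (AP - {q})"
    using L by (auto simp: L'_def)
  have "{s \<in> nodes T. q \<in> L' s} = A" using A by (auto simp: L'_def)
  then have "hqctl_sat (insert q AP) (T\<lparr>label := L'\<rparr>) \<sigma> e i \<phi>"
    using step[of L'] L' A by (auto simp: L'_def)
  then show "hqctl_sat AP (T\<lparr>label := L\<rparr>) \<sigma> e i (HExProp q \<phi>)"
    using L' by auto
qed


section \<open>From HyperQCTL* to MSO[E]\<close>

abbreviation MAnd :: "'p mso \<Rightarrow> 'p mso \<Rightarrow> 'p mso" where
  "MAnd \<phi> \<psi> \<equiv> MNot (MOr (MNot \<phi>) (MNot \<psi>))"

abbreviation MImp :: "'p mso \<Rightarrow> 'p mso \<Rightarrow> 'p mso" where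
  "MImp \<phi> \<psi> \<equiv> MOr (MNot \<phi>) \<psi>"

abbreviation MAllNode :: "nat \<Rightarrow> 'p mso \<Rightarrow> 'p mso" where
  "MAllNode x \<phi> \<equiv> MNot (MExNode x (MNot \<phi>))"

abbreviation MAllSet :: "nat \<Rightarrow> 'p mso \<Rightarrow> 'p mso" where
  "MAllSet X \<phi> \<equiv> MNot (MExSet X (MNot \<phi>))"

abbreviation MLessEq :: "nat \<Rightarrow> nat \<Rightarrow> 'p mso" where
  "MLessEq x y \<equiv> MOr (MEq x y) (MLess x y)"

definition MRoot :: "nat \<Rightarrow> 'p mso" where
  "MRoot x = MAllNode (Suc x) (MLessEq x (Suc x))"

text \<open>\<open>Suc (x + y)\<close> exceeds both arguments, so binding it captures
  neither.\<close>

definition MChild :: "nat \<Rightarrow> nat \<Rightarrow> 'p mso" where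
  "MChild x y = MAnd (MLess x y)
     (MNot (MExNode (Suc (x + y)) (MAnd (MLess x (Suc (x + y))) (MLess (Suc (x + y)) y))))"

definition MSubset :: "nat \<Rightarrow> nat \<Rightarrow> 'p mso" where
  "MSubset X Y = MAllNode 0 (MImp (MIn 0 X) (MIn 0 Y))"

definition MSerial :: "nat \<Rightarrow> 'p mso" where
  "MSerial X = MAnd (MExNode 0 (MAnd (MIn 0 X) (MRoot 0)))
     (MAllNode 0 (MImp (MIn 0 X) (MExNode 1 (MAnd (MIn 1 X) (MChild 0 1)))))"

text \<open>The minimality characterization of path ranges, with \<open>Suc X\<close> as the
  competing serial set.\<close>

definition MPath :: "nat \<Rightarrow> 'p mso" where
  "MPath X = MAnd (MSerial X)
     (MAllSet (Suc X) (MImp (MAnd (MSubset (Suc X) X) (MSerial (Suc X))) (MSubset X (Suc X))))"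

text \<open>A tree has a node, so some valuation is admissible and the quantification in
  \<open>mso_models\<close> is not vacuous.\<close>

lemma mso_models_iff:
  assumes "is_tree T" "\<And>v V. mso_sat T v V \<psi> \<longleftrightarrow> P"
  shows "mso_models T \<psi> \<longleftrightarrow> P"
proof -
  obtain r where "r \<in> nodes T" using nodes_nonempty[OF assms(1)] by blast
  then have "\<exists>v V. (\<forall>x :: nat. v x \<in> nodes T) \<and> (\<forall>X :: nat. V X \<subseteq> nodes T)"
    by (intro exI[of _ "\<lambda>_. r"] exI[of _ "\<lambda>_. {}"]) simp
  then show ?thesis unfolding mso_models_def assms(2) by blast
qed

lemma mso_sat_MRoot [simp]:
  "v x \<in> nodes T \<Longrightarrow> mso_sat T v V (MRoot x) \<longleftrightarrow> is_root T (v x)"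
  by (auto simp: MRoot_def is_root_def)

lemma mso_sat_MChild [simp]:
  "v x \<in> nodes T \<Longrightarrow> v y \<in> nodes T \<Longrightarrow> mso_sat T v V (MChild x y) \<longleftrightarrow> direct_anc T (v x) (v y)"
  by (auto simp: MChild_def direct_anc_def)

lemma mso_sat_MSubset [simp]:
  "V X \<subseteq> nodes T \<Longrightarrow> mso_sat T v V (MSubset X Y) \<longleftrightarrow> V X \<subseteq> V Y"
  by (auto simp: MSubset_def)

lemma mso_sat_MSerial [simp]:
  "V X \<subseteq> nodes T \<Longrightarrow> mso_sat T v V (MSerial X) \<longleftrightarrow> serial_set T (V X)"
  by (simp add: MSerial_def serial_set_def) blast

lemma mso_sat_MPath [simp]:
  "is_tree T \<Longrightarrow> V X \<subseteq> nodes T \<Longrightarrow> mso_sat T v V (MPath X) \<longleftrightarrow> (\<exists>p\<in>paths T. V X = range p)"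
  by (simp add: path_range_iff_minimal MPath_def) (blast dest: subset_trans)

text \<open>Path ranges consist of nodes, so a set quantifier relativized by \<open>MPath\<close> is
  a path quantifier. The first equation detects whether a clock exists.\<close>

lemma mso_sat_MExSet_MPath:
  assumes "is_tree T"
  shows "mso_sat T v V (MExSet X (MPath X)) \<longleftrightarrow> paths T \<noteq> {}"
    and "mso_sat T v V (MExSet X (MAnd (MPath X) \<phi>)) \<longleftrightarrow>
      (\<exists>p\<in>paths T. mso_sat T v (V(X := range p)) \<phi>)"
proof -
  have "range p \<subseteq> nodes T" if "p \<in> paths T" for p
    using path_in_nodes[OF that] by auto
  then show "mso_sat T v V (MExSet X (MPath X)) \<longleftrightarrow> paths T \<noteq> {}"
    "mso_sat T v V (MExSet X (MAnd (MPath X) \<phi>)) \<longleftrightarrow>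
      (\<exists>p\<in>paths T. mso_sat T v (V(X := range p)) \<phi>)"
    using assms by (simp_all cong: conj_cong) blast+
qed

lemma MPath_free [simp]:
  "mso_free_nodes (MPath X) = {}" "mso_free_sets (MPath X) = {X}" "mso_props (MPath X) = {}"
  by (auto simp: MPath_def MSerial_def MSubset_def MChild_def MRoot_def)

lemma MRoot_free [simp]:
  "mso_free_nodes (MRoot x) = {x}" "mso_free_sets (MRoot x) = {}" "mso_props (MRoot x) = {}"
  by (auto simp: MRoot_def)

lemma MChild_free [simp]:
  "mso_free_nodes (MChild x y) = {x, y}" "mso_free_sets (MChild x y) = {}"
  "mso_props (MChild x y) = {}"
  by (auto simp: MChild_def)

section \<open>Translation into MSO[E]\<close>

abbreviation (input) clock_var :: nat where
  "clock_var \<equiv> 0"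

text \<open>Odd set variables hold paths, positive even ones propositions; 0 is left to the
  clock.\<close>

definition path_var :: "nat \<Rightarrow> nat" where
  "path_var \<pi> = Suc (2 * \<pi>)"

definition prop_var :: "nat \<Rightarrow> nat" where
  "prop_var k = Suc (Suc (2 * k))"

lemma var_distinct [simp]:
  "path_var \<pi> \<noteq> 0" "prop_var k \<noteq> 0" "0 \<noteq> path_var \<pi>" "0 \<noteq> prop_var k"
  "path_var \<pi> \<noteq> prop_var k" "prop_var k \<noteq> path_var \<pi>"
  "path_var \<pi> = path_var \<pi>' \<longleftrightarrow> \<pi> = \<pi>'" "prop_var k = prop_var k' \<longleftrightarrow> k = k'"
  by (auto simp: path_var_def prop_var_def) presburger+

text \<open>Here \<open>f\<close> numbers the propositions, \<open>B\<close> contains the quantified ones in scope,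
  \<open>\<epsilon>\<close> is the most recently quantified path variable, and the node variable \<open>y\<close> holds the
  clock node of the current position. In the case of a path quantifier, the branching node is fixed
  before the path, since \<open>\<pi>\<close> and \<open>\<epsilon>\<close> may be the same variable.\<close>

primrec to_mso ::
  "('p \<Rightarrow> nat) \<Rightarrow> 'p hqctl \<Rightarrow> 'p set \<Rightarrow> nat option \<Rightarrow> nat \<Rightarrow> 'p mso" where
  "to_mso f (HAtom a \<pi>) B \<epsilon> y =
     MExNode (Suc y) (MAnd (MAnd (MIn (Suc y) (path_var \<pi>)) (MLevel (Suc y) y))
       (if a \<in> B then MIn (Suc y) (prop_var (f a)) else MPred a (Suc y)))"
| "to_mso f (HNot \<phi>) B \<epsilon> y = MNot (to_mso f \<phi> B \<epsilon> y)"
| "to_mso f (HOr \<phi> \<psi>) B \<epsilon> y = MOr (to_mso f \<phi> B \<epsilon> y) (to_mso f \<psi> B \<epsilon> y)"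
| "to_mso f (HNext \<phi>) B \<epsilon> y =
     MExNode (Suc y) (MAnd (MAnd (MIn (Suc y) clock_var) (MChild y (Suc y)))
       (to_mso f \<phi> B \<epsilon> (Suc y)))"
| "to_mso f (HUntil \<phi> \<psi>) B \<epsilon> y =
     MExNode (Suc y) (MAnd (MAnd (MIn (Suc y) clock_var) (MLessEq y (Suc y)))
       (MAnd (to_mso f \<psi> B \<epsilon> (Suc y))
         (MAllNode (Suc (Suc y))
           (MImp (MAnd (MIn (Suc (Suc y)) clock_var)
                    (MAnd (MLessEq y (Suc (Suc y))) (MLess (Suc (Suc y)) (Suc y))))
             (to_mso f \<phi> B \<epsilon> (Suc (Suc y)))))))"
| "to_mso f (HExPath \<pi> \<phi>) B \<epsilon> y =
     (case \<epsilon> of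
        None \<Rightarrow> MExSet (path_var \<pi>) (MAnd (MPath (path_var \<pi>)) (to_mso f \<phi> B (Some \<pi>) y))
      | Some \<pi>' \<Rightarrow> MExNode (Suc y) (MAnd (MAnd (MIn (Suc y) (path_var \<pi>')) (MLevel (Suc y) y))
          (MExSet (path_var \<pi>) (MAnd (MAnd (MPath (path_var \<pi>)) (MIn (Suc y) (path_var \<pi>)))
            (to_mso f \<phi> B (Some \<pi>) y)))))"
| "to_mso f (HExProp q \<phi>) B \<epsilon> y = MExSet (prop_var (f q)) (to_mso f \<phi> (insert q B) \<epsilon> y)"

text \<open>Each recursive call keeps \<open>y\<close> or moves to a larger node variable that is
  bound on the spot.\<close>

lemma to_mso_free_nodes: "mso_free_nodes (to_mso f \<phi> B \<epsilon> y) \<subseteq> {y}"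
proof (induction \<phi> arbitrary: B \<epsilon> y)
  case (HNext \<phi>)
  show ?case using HNext[of B \<epsilon> "Suc y"] by auto
next
  case (HUntil \<phi> \<psi>)
  show ?case using HUntil(1)[of B \<epsilon> "Suc (Suc y)"] HUntil(2)[of B \<epsilon> "Suc y"] by auto
next
  case (HExPath \<pi> \<phi>)
  show ?case using HExPath[of B "Some \<pi>" y] by (cases \<epsilon>) auto
next
  case (HExProp q \<phi>)
  show ?case using HExProp[of "insert q B" \<epsilon> y] by auto
qed (simp_all, blast)

text \<open>The variable in \<open>\<epsilon>\<close> counts as well: the next path quantifier
  mentions it to fix the branching node, even where it is not free in \<open>\<phi>\<close>.\<close>

lemma to_mso_free_sets:
  "mso_free_sets (to_mso f \<phi> B \<epsilon> y) \<subseteq>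
     {clock_var} \<union> path_var ` (free_paths \<phi> \<union> set_option \<epsilon>) \<union> (prop_var \<circ> f) ` B"
proof (induction \<phi> arbitrary: B \<epsilon> y)
  case (HNext \<phi>)
  show ?case using HNext[of B \<epsilon> "Suc y"] by auto
next
  case (HUntil \<phi> \<psi>)
  show ?case using HUntil(1)[of B \<epsilon> "Suc (Suc y)"] HUntil(2)[of B \<epsilon> "Suc y"] by auto
next
  case (HExPath \<pi> \<phi>)
  show ?case using HExPath[of B "Some \<pi>" y] by (cases \<epsilon>) auto
next
  case (HExProp q \<phi>)
  show ?case using HExProp[of "insert q B" \<epsilon> y] by auto
qed (simp_all, blast)

lemma to_mso_props: "mso_props (to_mso f \<phi> B \<epsilon> y) \<subseteq> free_props \<phi> - B"
proof (induction \<phi> arbitrary: B \<epsilon> y)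
  case (HNext \<phi>)
  show ?case using HNext[of B \<epsilon> "Suc y"] by auto
next
  case (HUntil \<phi> \<psi>)
  show ?case using HUntil(1)[of B \<epsilon> "Suc (Suc y)"] HUntil(2)[of B \<epsilon> "Suc y"] by auto
next
  case (HExPath \<pi> \<phi>)
  show ?case using HExPath[of B "Some \<pi>" y] by (cases \<epsilon>) auto
next
  case (HExProp q \<phi>)
  show ?case using HExProp[of "insert q B" \<epsilon> y] by auto
qed (simp_all, blast)

text \<open>Bound propositions are included, since \<open>f\<close> selects their set variables and
  must separate them.\<close>

primrec all_props :: "'p hqctl \<Rightarrow> 'p set" where
  "all_props (HAtom a \<pi>) = {a}"
| "all_props (HNot \<phi>) = all_props \<phi>"
| "all_props (HOr \<phi> \<psi>) = all_props \<phi> \<union> all_props \<psi>"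
| "all_props (HNext \<phi>) = all_props \<phi>"
| "all_props (HUntil \<phi> \<psi>) = all_props \<phi> \<union> all_props \<psi>"
| "all_props (HExPath \<pi> \<phi>) = all_props \<phi>"
| "all_props (HExProp q \<phi>) = insert q (all_props \<phi>)"

lemma finite_all_props: "finite (all_props \<phi>)"
  by (induction \<phi>) auto

text \<open>The invariant: \<open>L\<close> is the current labeling, read off from \<open>V\<close>
  for propositions in \<open>B\<close> and from \<open>T\<close> for the others; \<open>V\<close>
  holds the ranges of the assigned paths and of the clock; \<open>v y\<close> is the clock node at
  position \<open>i\<close>.\<close>

lemma to_mso_correct:
  fixes T :: "('s, 'p) ltree"
  assumes tree: "is_tree T" and clock: "c \<in> paths T" and f: "inj_on f F"
  assumes "all_props \<phi> \<subseteq> F" "B \<subseteq> F"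
    and "free_paths \<phi> \<subseteq> dom \<sigma>" "set_option \<epsilon> \<subseteq> dom \<sigma>"
    and "\<forall>s\<in>nodes T. L s \<subseteq> AP"
    and "\<forall>s\<in>nodes T. \<forall>a. a \<in> L s \<longleftrightarrow> (if a \<in> B then s \<in> V (prop_var (f a)) else a \<in> label T s)"
    and "\<forall>\<pi> p. \<sigma> \<pi> = Some p \<longrightarrow> p \<in> paths T \<and> V (path_var \<pi>) = range p"
    and "V clock_var = range c" and "v y = c i"
  shows "mso_sat T v V (to_mso f \<phi> B \<epsilon> y) \<longleftrightarrow>
    hqctl_sat AP (T\<lparr>label := L\<rparr>) \<sigma> (Option.bind \<epsilon> \<sigma>) i \<phi>"
proof -
  have clock_nodes: "c j \<in> nodes T" for j
    by (rule path_in_nodes[OF clock])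
  \<comment> \<open>Nodes restricted to the clock set correspond to positions, so node quantifiers
    become quantifiers over naturals.\<close>
  have clock_bex: "(\<exists>s\<in>nodes T. s \<in> range c \<and> P s) \<longleftrightarrow> (\<exists>j. P (c j))" for P
    using clock_nodes by blast
  have clock_ball: "(\<forall>s\<in>nodes T. s \<in> range c \<longrightarrow> P s) \<longleftrightarrow> (\<forall>j. P (c j))" for P
    using clock_nodes by blast
  show ?thesis
    using assms(4-)
  proof (induction \<phi> arbitrary: AP L B \<sigma> \<epsilon> v V y i)
    case (HAtom a \<pi>)
    then obtain p where p: "\<sigma> \<pi> = Some p" by auto
    with HAtom have pp: "p \<in> paths T" "V (path_var \<pi>) = range p" by auto
    \<comment> \<open>Among the nodes of \<open>p\<close>, the level predicate singles out the one
      at the clock position.\<close>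
    have *: "s \<in> nodes T \<and> s \<in> range p \<and> ancestors T s \<approx> ancestors T (c i) \<longleftrightarrow> s = p i" for s
      using path_level_iff[OF tree pp(1) clock] path_in_nodes[OF pp(1)] by auto
    have "mso_sat T v V (to_mso f (HAtom a \<pi>) B \<epsilon> y) \<longleftrightarrow>
      (\<exists>s. s = p i \<and> (if a \<in> B then s \<in> V (prop_var (f a)) else a \<in> label T s))"
      unfolding *[symmetric] using HAtom.prems pp by auto
    also have "\<dots> \<longleftrightarrow> a \<in> L (p i)"
      using HAtom.prems(6) path_in_nodes[OF pp(1)] by auto
    finally show ?case using p by simp
  next
    case (HNot \<phi>)
    have "mso_sat T v V (to_mso f \<phi> B \<epsilon> y) \<longleftrightarrow>
        hqctl_sat AP (T\<lparr>label := L\<rparr>) \<sigma> (Option.bind \<epsilon> \<sigma>) i \<phi>"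
      by (rule HNot.IH) (use HNot.prems in auto)
    then show ?case by simp
  next
    case (HOr \<phi> \<psi>)
    have "mso_sat T v V (to_mso f \<phi> B \<epsilon> y) \<longleftrightarrow>
        hqctl_sat AP (T\<lparr>label := L\<rparr>) \<sigma> (Option.bind \<epsilon> \<sigma>) i \<phi>"
      by (rule HOr.IH) (use HOr.prems in auto)
    moreover have "mso_sat T v V (to_mso f \<psi> B \<epsilon> y) \<longleftrightarrow>
        hqctl_sat AP (T\<lparr>label := L\<rparr>) \<sigma> (Option.bind \<epsilon> \<sigma>) i \<psi>"
      by (rule HOr.IH) (use HOr.prems in auto)
    ultimately show ?case by simp
  next
    case (HNext \<phi>)
    have IH: "mso_sat T (v(Suc y := c (Suc i))) V (to_mso f \<phi> B \<epsilon> (Suc y)) \<longleftrightarrow>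
        hqctl_sat AP (T\<lparr>label := L\<rparr>) \<sigma> (Option.bind \<epsilon> \<sigma>) (Suc i) \<phi>"
      by (rule HNext.IH) (use HNext.prems in auto)
    have "mso_sat T v V (to_mso f (HNext \<phi>) B \<epsilon> y) \<longleftrightarrow>
        (\<exists>j. direct_anc T (c i) (c j) \<and> mso_sat T (v(Suc y := c j)) V (to_mso f \<phi> B \<epsilon> (Suc y)))"
      using HNext.prems(8,9) by (simp add: clock_bex clock_nodes)
    \<comment> \<open>\<open>c i\<close> has only one child on the clock, so \<open>j\<close> is
      \<open>Suc i\<close>.\<close>
    then show ?case by (simp add: path_direct_anc_iff[OF tree clock] IH)
  next
    case (HUntil \<phi> \<psi>)
    have IH1: "mso_sat T (v(Suc y := c j, Suc (Suc y) := c k)) V (to_mso f \<phi> B \<epsilon> (Suc (Suc y))) \<longleftrightarrow>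
        hqctl_sat AP (T\<lparr>label := L\<rparr>) \<sigma> (Option.bind \<epsilon> \<sigma>) k \<phi>" for j k
      by (rule HUntil.IH) (use HUntil.prems in auto)
    have IH2: "mso_sat T (v(Suc y := c j)) V (to_mso f \<psi> B \<epsilon> (Suc y)) \<longleftrightarrow>
        hqctl_sat AP (T\<lparr>label := L\<rparr>) \<sigma> (Option.bind \<epsilon> \<sigma>) j \<psi>" for j
      by (rule HUntil.IH) (use HUntil.prems in auto)
    have "mso_sat T v V (to_mso f (HUntil \<phi> \<psi>) B \<epsilon> y) \<longleftrightarrow>
        (\<exists>s\<in>nodes T. s \<in> range c \<and> (c i = s \<or> anc T (c i) s) \<and>
          mso_sat T (v(Suc y := s)) V (to_mso f \<psi> B \<epsilon> (Suc y)) \<and>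
          (\<forall>t\<in>nodes T. t \<in> range c \<longrightarrow> (c i = t \<or> anc T (c i) t) \<and> anc T t s \<longrightarrow>
            mso_sat T (v(Suc y := s, Suc (Suc y) := t)) V (to_mso f \<phi> B \<epsilon> (Suc (Suc y)))))"
      using HUntil.prems(8,9) by (intro iffI; simp; blast)
    also have "\<dots> \<longleftrightarrow> (\<exists>j. (i = j \<or> i < j) \<and>
          mso_sat T (v(Suc y := c j)) V (to_mso f \<psi> B \<epsilon> (Suc y)) \<and>
          (\<forall>k. (i = k \<or> i < k) \<and> k < j \<longrightarrow>
            mso_sat T (v(Suc y := c j, Suc (Suc y) := c k)) V (to_mso f \<phi> B \<epsilon> (Suc (Suc y)))))"
      unfolding clock_bex clock_ball path_eq_iff[OF tree clock] path_anc_iff[OF tree clock] ..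
    moreover have "i = k \<or> i < k \<longleftrightarrow> i \<le> k" for k
      by auto
    ultimately show ?case by (simp add: IH1 IH2 Ball_def)
  next
    case (HExPath \<pi> \<phi>)
    \<comment> \<open>Any \<open>v'\<close> agreeing with \<open>v\<close> at \<open>y\<close> is
      allowed, because in the branching case \<open>Suc y\<close> has been rebound to the branching
      node.\<close>
    have IH: "mso_sat T v' (V(path_var \<pi> := range p)) (to_mso f \<phi> B (Some \<pi>) y) \<longleftrightarrow>
        hqctl_sat AP (T\<lparr>label := L\<rparr>) (\<sigma>(\<pi> \<mapsto> p)) (Some p) i \<phi>"
      if "p \<in> paths T" "v' y = v y" for p v'
    proof -
      have "mso_sat T v' (V(path_var \<pi> := range p)) (to_mso f \<phi> B (Some \<pi>) y) \<longleftrightarrow>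
          hqctl_sat AP (T\<lparr>label := L\<rparr>) (\<sigma>(\<pi> \<mapsto> p)) (Option.bind (Some \<pi>) (\<sigma>(\<pi> \<mapsto> p))) i \<phi>"
        by (rule HExPath.IH) (use HExPath.prems that in auto)
      then show ?thesis by simp
    qed
    have ran: "range p \<subseteq> nodes T" if "p \<in> paths T" for p
      using path_in_nodes[OF that] by auto
    show ?case
    proof (cases \<epsilon>)
      case None
      then show ?thesis
        using mso_sat_MExSet_MPath(2)[OF tree, of v V "path_var \<pi>"] by (simp add: IH)
    next
      case (Some \<pi>')
      then obtain p' where p': "\<sigma> \<pi>' = Some p'" using HExPath.prems by auto
      then have pp: "p' \<in> paths T" "V (path_var \<pi>') = range p'" using HExPath.prems by auto
      have *: "s \<in> nodes T \<and> s \<in> range p' \<and> ancestors T s \<approx> ancestors T (c i) \<longleftrightarrow> s = p' i" for s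
        using path_level_iff[OF tree pp(1) clock] path_in_nodes[OF pp(1)] by auto
      \<comment> \<open>Passing through the node of \<open>p'\<close> at the current position forces
        the whole prefix, since paths meet only at equal indices.\<close>
      have meet: "p' i \<in> range p \<longleftrightarrow> (\<forall>k\<le>i. p k = p' k)" if "p \<in> paths T" for p
      proof -
        have "p' i \<in> range p \<longleftrightarrow> p i = p' i"
        proof
          assume "p' i \<in> range p"
          then obtain j where "p' i = p j" by auto
          then show "p i = p' i" using paths_meet_imp_eq_index[OF tree pp(1) that] by metis
        next
          assume "p i = p' i"
          then show "p' i \<in> range p" by (metis rangeI)
        qed
        then show ?thesis using path_prefix_iff[OF tree that pp(1)] by simp
      qed
      have "mso_sat T v V (to_mso f (HExPath \<pi> \<phi>) B \<epsilon> y) \<longleftrightarrow>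
          (\<exists>s. s = p' i \<and> (\<exists>A\<subseteq>nodes T. (\<exists>p\<in>paths T. A = range p) \<and> s \<in> A \<and>
            mso_sat T (v(Suc y := s)) (V(path_var \<pi> := A)) (to_mso f \<phi> B (Some \<pi>) y)))"
        unfolding *[symmetric] using Some HExPath.prems pp
        by (auto simp: tree Bex_def cong: conj_cong)
      also have "\<dots> \<longleftrightarrow> (\<exists>p\<in>paths T. p' i \<in> range p \<and>
            mso_sat T (v(Suc y := p' i)) (V(path_var \<pi> := range p)) (to_mso f \<phi> B (Some \<pi>) y))"
        using ran by blast
      also have "\<dots> \<longleftrightarrow> (\<exists>p\<in>paths T. (\<forall>k\<le>i. p k = p' k) \<and>
          hqctl_sat AP (T\<lparr>label := L\<rparr>) (\<sigma>(\<pi> \<mapsto> p)) (Some p) i \<phi>)"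
        by (intro bex_cong refl conj_cong meet IH) auto
      finally show ?thesis using Some p' by simp
    qed
  next
    case (HExProp q \<phi>)
    \<comment> \<open>Updating the set variable of \<open>q\<close> leaves those of the other
      propositions in scope alone.\<close>
    have fq: "f a = f q \<longleftrightarrow> a = q" if "a \<in> B" for a
      using f that HExProp.prems(1,2) by (auto simp: inj_on_def)
    have "hqctl_sat (insert q AP) (T\<lparr>label := L'\<rparr>) \<sigma> (Option.bind \<epsilon> \<sigma>) i \<phi> \<longleftrightarrow>
        mso_sat T v (V(prop_var (f q) := {s \<in> nodes T. q \<in> L' s})) (to_mso f \<phi> (insert q B) \<epsilon> y)"
      if "\<forall>s\<in>nodes T. L' s \<subseteq> insert q AP"
        "\<forall>s\<in>nodes T. \<forall>a. a \<noteq> q \<longrightarrow> (a \<in> L' s \<longleftrightarrow> a \<in> L s)" for L'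
      by (rule HExProp.IH[symmetric]) (use HExProp.prems that fq in auto)
    from hqctl_sat_HExProp_iff[of T L AP q \<sigma> "Option.bind \<epsilon> \<sigma>" i \<phi>
        "\<lambda>A. mso_sat T v (V(prop_var (f q) := A)) (to_mso f \<phi> (insert q B) \<epsilon> y)", OF _ this]
    show ?case using HExProp.prems(5) by simp
  qed
qed

section \<open>Trees without paths\<close>

primrec holds_without_paths :: "'p hqctl \<Rightarrow> bool" where
  "holds_without_paths (HAtom a \<pi>) = False"
| "holds_without_paths (HNot \<phi>) = (\<not> holds_without_paths \<phi>)"
| "holds_without_paths (HOr \<phi> \<psi>) = (holds_without_paths \<phi> \<or> holds_without_paths \<psi>)"
| "holds_without_paths (HNext \<phi>) = holds_without_paths \<phi>"
| "holds_without_paths (HUntil \<phi> \<psi>) = holds_without_paths \<psi>"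
| "holds_without_paths (HExPath \<pi> \<phi>) = False"
| "holds_without_paths (HExProp q \<phi>) = holds_without_paths \<phi>"

text \<open>A root with infinitely many leaves is a tree without paths. There path quantifiers fail,
  the assignment stays empty and atoms are false by default; nothing depends on positions or labels,
  so an until reduces to its second argument.\<close>

lemma hqctl_sat_without_paths:
  assumes "paths T = {}" "\<forall>s\<in>nodes T. L s \<subseteq> AP"
  shows "hqctl_sat AP (T\<lparr>label := L\<rparr>) Map.empty e i \<phi> \<longleftrightarrow> holds_without_paths \<phi>"
  using assms
proof (induction \<phi> arbitrary: AP L i)
  case (HExProp q \<phi>)
  then have "hqctl_sat AP (T\<lparr>label := L\<rparr>) Map.empty e i (HExProp q \<phi>) \<longleftrightarrow>
      (\<exists>A\<subseteq>nodes T. holds_without_paths \<phi>)"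
    by (intro hqctl_sat_HExProp_iff) auto
  then show ?case by auto
qed auto

lemma hqctl_to_mso:
  assumes "hqctl_formula_over AP \<phi>"
  shows "\<exists>\<psi>. mso_sentence_over AP \<psi> \<and>
    (\<forall>T :: ('s, 'p) ltree. labeled_tree AP T \<longrightarrow> (hqctl_models AP T \<phi> \<longleftrightarrow> mso_models T \<psi>))"
proof -
  obtain f :: "'p \<Rightarrow> nat" where f: "inj_on f (all_props \<phi>)"
    using finite_all_props by (metis finite_imp_inj_to_nat_seg)
  \<comment> \<open>Any path may serve as clock, as \<open>run\<close> below shows; evaluation
    starts at the root, the clock node of position 0.\<close>
  define \<psi>\<^sub>1 where "\<psi>\<^sub>1 = MExSet clock_var (MAnd (MPath clock_var)
    (MExNode 0 (MAnd (MRoot 0) (to_mso f \<phi> {} None 0))))"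
  \<comment> \<open>\<open>\<psi>\<^sub>1\<close> fails on every tree without paths; where the
    formula holds there, a disjunct repairs this.\<close>
  define \<psi> where "\<psi> =
    (if holds_without_paths \<phi> then MOr \<psi>\<^sub>1 (MNot (MExSet clock_var (MPath clock_var))) else \<psi>\<^sub>1)"
  have free: "free_paths \<phi> = {}" "free_props \<phi> \<subseteq> AP"
    using assms by (auto simp: hqctl_formula_over_def)
  then have "mso_sentence_over AP \<psi>"
    using to_mso_free_nodes[of f \<phi> "{}" None 0] to_mso_free_sets[of f \<phi> "{}" None 0]
      to_mso_props[of f \<phi> "{}" None 0]
    by (auto simp: mso_sentence_over_def \<psi>_def \<psi>\<^sub>1_def)
  moreover have "hqctl_models AP T \<phi> \<longleftrightarrow> mso_models T \<psi>" if T: "labeled_tree AP T"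
    for T :: "('s, 'p) ltree"
  proof -
    have tree: "is_tree T" and lab: "\<forall>s\<in>nodes T. label T s \<subseteq> AP"
      using T by (auto simp: labeled_tree_def)
    have run: "mso_sat T v (V(clock_var := range c)) (MExNode 0 (MAnd (MRoot 0) (to_mso f \<phi> {} None 0))) \<longleftrightarrow>
        hqctl_models AP T \<phi>" if c: "c \<in> paths T" for v V c
    proof -
      have "mso_sat T (v(0 := c 0)) (V(clock_var := range c)) (to_mso f \<phi> {} None 0) \<longleftrightarrow>
          hqctl_sat AP (T\<lparr>label := label T\<rparr>) Map.empty (Option.bind (None :: nat option) Map.empty) 0 \<phi>"
        by (rule to_mso_correct[OF tree c f]) (use free lab in auto)
      moreover have "(\<exists>s\<in>nodes T. is_root T s \<and> P s) \<longleftrightarrow> P (c 0)" for P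
        using path_root[OF c] path_in_nodes[OF c] root_unique[OF tree] by metis
      ultimately show ?thesis
        by (simp add: hqctl_models_def)
    qed
    have "mso_sat T v V \<psi>\<^sub>1 \<longleftrightarrow> paths T \<noteq> {} \<and> hqctl_models AP T \<phi>" for v V
      unfolding \<psi>\<^sub>1_def mso_sat_MExSet_MPath[OF tree] using run by blast
    moreover have "hqctl_models AP T \<phi> \<longleftrightarrow> holds_without_paths \<phi>" if "paths T = {}"
      using hqctl_sat_without_paths[OF that lab] by (simp add: hqctl_models_def)
    ultimately have "mso_sat T v V \<psi> \<longleftrightarrow> hqctl_models AP T \<phi>" for v V
      using mso_sat_MExSet_MPath(1)[OF tree, of v V clock_var]
      by (auto simp: \<psi>_def simp del: mso_sat.simps(9))
    then show ?thesis using mso_models_iff[OF tree] by blast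
  qed
  ultimately show ?thesis by blast
qed


section \<open>From MSO[E] to HyperQCTL*\<close>

abbreviation HAnd :: "'p hqctl \<Rightarrow> 'p hqctl \<Rightarrow> 'p hqctl" where
  "HAnd \<phi> \<psi> \<equiv> HNot (HOr (HNot \<phi>) (HNot \<psi>))"

text \<open>A tautology built from \<open>\<phi>\<close> itself stands for truth and brings in no
  further path variables or propositions.\<close>

abbreviation HEventually :: "'p hqctl \<Rightarrow> 'p hqctl" where
  "HEventually \<phi> \<equiv> HUntil (HOr \<phi> (HNot \<phi>)) \<phi>"

definition HNonempty :: "'p \<Rightarrow> 'p hqctl" where
  "HNonempty q = HExPath 0 (HEventually (HAtom q 0))"

text \<open>If \<open>q\<close> marks a single node, this says that \<open>r\<close> holds there; it
  serves for labels, equality and set membership alike.\<close>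

definition HMeets :: "'p \<Rightarrow> 'p \<Rightarrow> 'p hqctl" where
  "HMeets q r = HExPath 0 (HEventually (HAnd (HAtom q 0) (HAtom r 0)))"

definition HSubset :: "'p \<Rightarrow> 'p \<Rightarrow> 'p hqctl" where
  "HSubset q r = HNot (HExPath 0 (HEventually (HAnd (HAtom q 0) (HNot (HAtom r 0)))))"

text \<open>\<open>HNext\<close> separates the two positions, as the order is strict.\<close>

definition HLess :: "'p \<Rightarrow> 'p \<Rightarrow> 'p hqctl" where
  "HLess q r = HExPath 0 (HEventually (HAnd (HAtom q 0) (HNext (HEventually (HAtom r 0)))))"

text \<open>The two paths are read synchronously, so the marked nodes occur at equal positions. At
  position 0 the second path need share only the root with the first.\<close>

definition HLevel :: "'p \<Rightarrow> 'p \<Rightarrow> 'p hqctl" where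
  "HLevel q r = HExPath 0 (HExPath 1 (HEventually (HAnd (HAtom q 0) (HAtom r 1))))"

text \<open>The proposition \<open>r\<close> must differ from \<open>q\<close>.\<close>

definition HSingleton :: "'p \<Rightarrow> 'p \<Rightarrow> 'p hqctl" where
  "HSingleton r q = HAnd (HNonempty q)
     (HNot (HExProp r (HAnd (HAnd (HSubset r q) (HNonempty r)) (HNot (HSubset q r)))))"

lemmas H_defs = HNonempty_def HMeets_def HSubset_def HLess_def HLevel_def HSingleton_def

abbreviation labeled_nodes :: "('s, 'p) ltree \<Rightarrow> ('s \<Rightarrow> 'p set) \<Rightarrow> 'p \<Rightarrow> 's set" where
  "labeled_nodes T L q \<equiv> {s \<in> nodes T. q \<in> L s}"

context
  fixes T :: "('s, 'p) ltree"
  assumes tree: "is_tree T" and covered: "covered_by_paths T"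
begin

text \<open>Here coverage enters: every node occurs on a path at some position, so a path quantifier
  followed by \<open>HEventually\<close> reaches all nodes.\<close>

lemma ex_path_iff_ex_node: "(\<exists>p\<in>paths T. \<exists>i. P (p i)) \<longleftrightarrow> (\<exists>s\<in>nodes T. P s)"
proof
  assume "\<exists>s\<in>nodes T. P s"
  then obtain s where "s \<in> nodes T" "P s" by blast
  moreover from this obtain p i where "p \<in> paths T" "s = p i"
    using covered unfolding covered_by_paths_def by blast
  ultimately show "\<exists>p\<in>paths T. \<exists>i. P (p i)" by auto
qed (auto intro: path_in_nodes)

lemma sat_HNonempty:
  "hqctl_sat AP (T\<lparr>label := L\<rparr>) Map.empty None 0 (HNonempty q) \<longleftrightarrow> labeled_nodes T L q \<noteq> {}"
  using ex_path_iff_ex_node[of "\<lambda>s. q \<in> L s"] by (auto simp: HNonempty_def)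

lemma sat_HMeets:
  "hqctl_sat AP (T\<lparr>label := L\<rparr>) Map.empty None 0 (HMeets q r) \<longleftrightarrow>
    (\<exists>s\<in>nodes T. q \<in> L s \<and> r \<in> L s)"
  using ex_path_iff_ex_node[of "\<lambda>s. q \<in> L s \<and> r \<in> L s"] by (simp add: HMeets_def)

lemma sat_HSubset:
  "hqctl_sat AP (T\<lparr>label := L\<rparr>) Map.empty None 0 (HSubset q r) \<longleftrightarrow>
    labeled_nodes T L q \<subseteq> labeled_nodes T L r"
  using ex_path_iff_ex_node[of "\<lambda>s. q \<in> L s \<and> r \<notin> L s"] by (auto simp: HSubset_def)

text \<open>A path through \<open>t\<close> passes through all ancestors of \<open>t\<close>, so two
  nodes related by the order lie on a common path.\<close>

lemma sat_HLess:
  "hqctl_sat AP (T\<lparr>label := L\<rparr>) Map.empty None 0 (HLess q r) \<longleftrightarrow>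
    (\<exists>s\<in>nodes T. \<exists>t\<in>nodes T. q \<in> L s \<and> r \<in> L t \<and> anc T s t)"
proof -
  have "hqctl_sat AP (T\<lparr>label := L\<rparr>) Map.empty None 0 (HLess q r) \<longleftrightarrow>
      (\<exists>p\<in>paths T. \<exists>j i. q \<in> L (p i) \<and> r \<in> L (p j) \<and> i < j)"
    by (auto simp: HLess_def Suc_le_eq)
  also have "\<dots> \<longleftrightarrow> (\<exists>p\<in>paths T. \<exists>j. \<exists>s\<in>nodes T. q \<in> L s \<and> r \<in> L (p j) \<and> anc T s (p j))"
  proof (intro bex_cong refl ex_cong1)
    fix p j assume p: "p \<in> paths T"
    have "s \<in> nodes T \<and> anc T s (p j) \<longleftrightarrow> s \<in> p ` {..<j}" for s
      using ancestors_path[OF tree p, of j] by (auto simp: ancestors_def)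
    then have "(\<exists>s\<in>nodes T. q \<in> L s \<and> r \<in> L (p j) \<and> anc T s (p j)) \<longleftrightarrow>
        (\<exists>s\<in>p ` {..<j}. q \<in> L s \<and> r \<in> L (p j))"
      by blast
    then show "(\<exists>i. q \<in> L (p i) \<and> r \<in> L (p j) \<and> i < j) \<longleftrightarrow>
        (\<exists>s\<in>nodes T. q \<in> L s \<and> r \<in> L (p j) \<and> anc T s (p j))"
      by auto
  qed
  also have "\<dots> \<longleftrightarrow> (\<exists>t\<in>nodes T. \<exists>s\<in>nodes T. q \<in> L s \<and> r \<in> L t \<and> anc T s t)"
    by (rule ex_path_iff_ex_node)
  finally show ?thesis by blast
qed

lemma sat_HLevel:
  "hqctl_sat AP (T\<lparr>label := L\<rparr>) Map.empty None 0 (HLevel q r) \<longleftrightarrow>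
    (\<exists>s\<in>nodes T. \<exists>t\<in>nodes T. q \<in> L s \<and> r \<in> L t \<and> ancestors T s \<approx> ancestors T t)"
proof -
  have "hqctl_sat AP (T\<lparr>label := L\<rparr>) Map.empty None 0 (HLevel q r) \<longleftrightarrow>
      (\<exists>p\<in>paths T. \<exists>p'\<in>paths T. p' 0 = p 0 \<and> (\<exists>i. q \<in> L (p i) \<and> r \<in> L (p' i)))"
    by (auto simp: HLevel_def)
  \<comment> \<open>All paths share the root, and equal levels mean equal indices, so the common
    index can be split into two.\<close>
  also have "\<dots> \<longleftrightarrow> (\<exists>p\<in>paths T. \<exists>i. \<exists>p'\<in>paths T. \<exists>j.
      q \<in> L (p i) \<and> r \<in> L (p' j) \<and> ancestors T (p i) \<approx> ancestors T (p' j))"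
    using path_level_iff[OF tree] root_unique[OF tree] path_root[of _ T] by metis
  also have "\<dots> \<longleftrightarrow>
      (\<exists>s\<in>nodes T. \<exists>t\<in>nodes T. q \<in> L s \<and> r \<in> L t \<and> ancestors T s \<approx> ancestors T t)"
    using ex_path_iff_ex_node[of
        "\<lambda>t. q \<in> L s \<and> r \<in> L t \<and> ancestors T s \<approx> ancestors T t" for s]
      ex_path_iff_ex_node[of
        "\<lambda>s. \<exists>t\<in>nodes T. q \<in> L s \<and> r \<in> L t \<and> ancestors T s \<approx> ancestors T t"]
    by simp
  finally show ?thesis .
qed

text \<open>A nonempty set is a singleton iff it has no nonempty proper subset. The quantified
  \<open>r\<close> ranges over candidate subsets, and \<open>r \<noteq> q\<close> keeps the
  extension of \<open>q\<close> fixed meanwhile.\<close>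

lemma sat_HSingleton:
  assumes "r \<noteq> q" "\<forall>s\<in>nodes T. L s \<subseteq> AP"
  shows "hqctl_sat AP (T\<lparr>label := L\<rparr>) Map.empty None 0 (HSingleton r q) \<longleftrightarrow>
    (\<exists>s. labeled_nodes T L q = {s})"
proof -
  let ?Q = "labeled_nodes T L q"
  have "hqctl_sat AP (T\<lparr>label := L\<rparr>) Map.empty None 0
      (HExProp r (HAnd (HAnd (HSubset r q) (HNonempty r)) (HNot (HSubset q r)))) \<longleftrightarrow>
      (\<exists>A\<subseteq>nodes T. (A \<subseteq> ?Q \<and> A \<noteq> {}) \<and> \<not> ?Q \<subseteq> A)"
  proof (rule hqctl_sat_HExProp_iff[OF assms(2)])
    fix L' assume "\<forall>s\<in>nodes T. \<forall>a. a \<noteq> r \<longrightarrow> (a \<in> L' s \<longleftrightarrow> a \<in> L s)"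
    then have "labeled_nodes T L' q = ?Q" using assms(1) by auto
    then show "hqctl_sat (insert r AP) (T\<lparr>label := L'\<rparr>) Map.empty None 0
        (HAnd (HAnd (HSubset r q) (HNonempty r)) (HNot (HSubset q r))) \<longleftrightarrow>
        (labeled_nodes T L' r \<subseteq> ?Q \<and> labeled_nodes T L' r \<noteq> {}) \<and> \<not> ?Q \<subseteq> labeled_nodes T L' r"
      by (simp only: hqctl_sat.simps(2,3) sat_HSubset sat_HNonempty de_Morgan_disj not_not)
  qed
  then have "hqctl_sat AP (T\<lparr>label := L\<rparr>) Map.empty None 0 (HSingleton r q) \<longleftrightarrow>
      ?Q \<noteq> {} \<and> \<not> (\<exists>A\<subseteq>nodes T. (A \<subseteq> ?Q \<and> A \<noteq> {}) \<and> \<not> ?Q \<subseteq> A)"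
    unfolding HSingleton_def by (simp only: hqctl_sat.simps(2,3) sat_HNonempty de_Morgan_disj not_not)
  also have "\<dots> \<longleftrightarrow> (\<exists>s. ?Q = {s})"
  proof
    assume Q: "?Q \<noteq> {} \<and> \<not> (\<exists>A\<subseteq>nodes T. (A \<subseteq> ?Q \<and> A \<noteq> {}) \<and> \<not> ?Q \<subseteq> A)"
    then obtain s where s: "s \<in> ?Q" by blast
    then have "{s} \<subseteq> nodes T \<and> {s} \<subseteq> ?Q \<and> {s} \<noteq> {}" by auto
    with Q have "?Q \<subseteq> {s}" by meson
    with s show "\<exists>s. ?Q = {s}" by blast
  next
    assume "\<exists>s. ?Q = {s}"
    then obtain s where "?Q = {s}" ..
    then show "?Q \<noteq> {} \<and> \<not> (\<exists>A\<subseteq>nodes T. (A \<subseteq> ?Q \<and> A \<noteq> {}) \<and> \<not> ?Q \<subseteq> A)"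
      by (simp only:) blast
  qed
  finally show ?thesis .
qed

end

section \<open>Translation into HyperQCTL*\<close>

definition aux_prop :: "(nat \<Rightarrow> 'p) \<Rightarrow> 'p" where
  "aux_prop g = g 0"

text \<open>Odd indices encode node variables, positive even ones set variables; index 0 is left to
  the singleton test.\<close>

definition node_prop :: "(nat \<Rightarrow> 'p) \<Rightarrow> nat \<Rightarrow> 'p" where
  "node_prop g x = g (Suc (2 * x))"

definition set_prop :: "(nat \<Rightarrow> 'p) \<Rightarrow> nat \<Rightarrow> 'p" where
  "set_prop g X = g (Suc (Suc (2 * X)))"

lemma prop_distinct:
  assumes "inj g"
  shows "aux_prop g \<noteq> node_prop g x"
    "node_prop g x = node_prop g x' \<longleftrightarrow> x = x'" "set_prop g X = set_prop g X' \<longleftrightarrow> X = X'"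
    "node_prop g x \<noteq> set_prop g X" "set_prop g X \<noteq> node_prop g x"
  using assms by (auto simp: aux_prop_def node_prop_def set_prop_def inj_eq) presburger+

primrec to_hqctl :: "(nat \<Rightarrow> 'p) \<Rightarrow> 'p mso \<Rightarrow> 'p hqctl" where
  "to_hqctl g (MPred a x) = HMeets (node_prop g x) a"
| "to_hqctl g (MLess x y) = HLess (node_prop g x) (node_prop g y)"
| "to_hqctl g (MEq x y) = HMeets (node_prop g x) (node_prop g y)"
| "to_hqctl g (MLevel x y) = HLevel (node_prop g x) (node_prop g y)"
| "to_hqctl g (MIn x X) = HMeets (node_prop g x) (set_prop g X)"
| "to_hqctl g (MNot \<phi>) = HNot (to_hqctl g \<phi>)"
| "to_hqctl g (MOr \<phi> \<psi>) = HOr (to_hqctl g \<phi>) (to_hqctl g \<psi>)"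
| "to_hqctl g (MExNode x \<phi>) = HExProp (node_prop g x)
     (HAnd (HSingleton (aux_prop g) (node_prop g x)) (to_hqctl g \<phi>))"
| "to_hqctl g (MExSet X \<phi>) = HExProp (set_prop g X) (to_hqctl g \<phi>)"

lemma to_hqctl_free_paths: "free_paths (to_hqctl g \<psi>) = {}"
  by (induction \<psi>) (auto simp: H_defs)

lemma to_hqctl_free_props:
  "free_props (to_hqctl g \<psi>) \<subseteq>
     mso_props \<psi> \<union> node_prop g ` mso_free_nodes \<psi> \<union> set_prop g ` mso_free_sets \<psi>"
  by (induction \<psi>) (auto simp: H_defs)

lemma finite_mso_props: "finite (mso_props \<psi>)"
  by (induction \<psi>) auto

text \<open>The invariant asks for correct markings of the free variables only. As \<open>F\<close>
  is disjoint from the encoding propositions, labels in \<open>F\<close> stay those of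
  \<open>T\<close> under every relabeling.\<close>

lemma to_hqctl_correct:
  fixes T :: "('s, 'p) ltree"
  assumes tree: "is_tree T" and covered: "covered_by_paths T"
    and g: "inj g" "range g \<inter> F = {}"
  assumes "mso_props \<psi> \<subseteq> F"
    and "\<forall>s\<in>nodes T. L s \<subseteq> AP"
    and "\<forall>s\<in>nodes T. \<forall>a\<in>F. a \<in> L s \<longleftrightarrow> a \<in> label T s"
    and "\<forall>x\<in>mso_free_nodes \<psi>. labeled_nodes T L (node_prop g x) = {v x}"
    and "\<forall>X\<in>mso_free_sets \<psi>. labeled_nodes T L (set_prop g X) = V X"
  shows "hqctl_sat AP (T\<lparr>label := L\<rparr>) Map.empty None 0 (to_hqctl g \<psi>) \<longleftrightarrow> mso_sat T v V \<psi>"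
  using assms(5-)
proof (induction \<psi> arbitrary: AP L v V)
  case (MPred a x)
  \<comment> \<open>The marking pins the existential node in \<open>HMeets\<close> down to
    \<open>v x\<close>.\<close>
  then have "v x \<in> nodes T" "\<And>s. s \<in> nodes T \<Longrightarrow> node_prop g x \<in> L s \<longleftrightarrow> s = v x" by auto
  then show ?case using MPred by (auto simp: sat_HMeets[OF tree covered])
next
  case (MLess x y)
  then have "v x \<in> nodes T" "\<And>s. s \<in> nodes T \<Longrightarrow> node_prop g x \<in> L s \<longleftrightarrow> s = v x"
    "v y \<in> nodes T" "\<And>s. s \<in> nodes T \<Longrightarrow> node_prop g y \<in> L s \<longleftrightarrow> s = v y" by auto
  then show ?case by (auto simp: sat_HLess[OF tree covered])
next
  case (MEq x y)
  then have "v x \<in> nodes T" "\<And>s. s \<in> nodes T \<Longrightarrow> node_prop g x \<in> L s \<longleftrightarrow> s = v x"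
    "v y \<in> nodes T" "\<And>s. s \<in> nodes T \<Longrightarrow> node_prop g y \<in> L s \<longleftrightarrow> s = v y" by auto
  then show ?case by (auto simp: sat_HMeets[OF tree covered])
next
  case (MLevel x y)
  then have "v x \<in> nodes T" "\<And>s. s \<in> nodes T \<Longrightarrow> node_prop g x \<in> L s \<longleftrightarrow> s = v x"
    "v y \<in> nodes T" "\<And>s. s \<in> nodes T \<Longrightarrow> node_prop g y \<in> L s \<longleftrightarrow> s = v y" by auto
  then show ?case by (auto simp: sat_HLevel[OF tree covered])
next
  case (MIn x X)
  then have "v x \<in> nodes T" "\<And>s. s \<in> nodes T \<Longrightarrow> node_prop g x \<in> L s \<longleftrightarrow> s = v x"
    "\<And>s. s \<in> nodes T \<Longrightarrow> set_prop g X \<in> L s \<longleftrightarrow> s \<in> V X" by auto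
  then show ?case by (auto simp: sat_HMeets[OF tree covered])
next
  case (MNot \<phi>)
  have "hqctl_sat AP (T\<lparr>label := L\<rparr>) Map.empty None 0 (to_hqctl g \<phi>) \<longleftrightarrow> mso_sat T v V \<phi>"
    by (rule MNot.IH) (use MNot.prems in auto)
  then show ?case by simp
next
  case (MOr \<phi> \<psi>)
  have "hqctl_sat AP (T\<lparr>label := L\<rparr>) Map.empty None 0 (to_hqctl g \<phi>) \<longleftrightarrow> mso_sat T v V \<phi>"
    by (rule MOr.IH) (use MOr.prems in auto)
  moreover
  have "hqctl_sat AP (T\<lparr>label := L\<rparr>) Map.empty None 0 (to_hqctl g \<psi>) \<longleftrightarrow> mso_sat T v V \<psi>"
    by (rule MOr.IH) (use MOr.prems in auto)
  ultimately show ?case by simp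
next
  case (MExNode x \<phi>)
  let ?q = "node_prop g x"
  \<comment> \<open>The singleton test admits only sets \<open>{s}\<close>, and \<open>s\<close>
    becomes the value of \<open>x\<close>.\<close>
  have "hqctl_sat AP (T\<lparr>label := L\<rparr>) Map.empty None 0 (to_hqctl g (MExNode x \<phi>)) \<longleftrightarrow>
      (\<exists>A\<subseteq>nodes T. \<exists>s. A = {s} \<and> mso_sat T (v(x := s)) V \<phi>)"
    unfolding to_hqctl.simps
  proof (rule hqctl_sat_HExProp_iff[OF MExNode.prems(2)])
    fix L' assume L': "\<forall>s\<in>nodes T. L' s \<subseteq> insert ?q AP"
      and agree: "\<forall>s\<in>nodes T. \<forall>a. a \<noteq> ?q \<longrightarrow> (a \<in> L' s \<longleftrightarrow> a \<in> L s)"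
    have fresh: "?q \<notin> F" using g(2) by (auto simp: node_prop_def)
    have same: "labeled_nodes T L' a = labeled_nodes T L a" if "a \<noteq> ?q" for a
      using agree that by auto
    have "hqctl_sat (insert ?q AP) (T\<lparr>label := L'\<rparr>) Map.empty None 0 (to_hqctl g \<phi>) \<longleftrightarrow>
        mso_sat T (v(x := s)) V \<phi>" if s: "labeled_nodes T L' ?q = {s}" for s
    proof (rule MExNode.IH)
      show "\<forall>s\<in>nodes T. \<forall>a\<in>F. a \<in> L' s \<longleftrightarrow> a \<in> label T s"
        using MExNode.prems(3) agree fresh by metis
      show "\<forall>y\<in>mso_free_nodes \<phi>. labeled_nodes T L' (node_prop g y) = {(v(x := s)) y}"
        using MExNode.prems(4) s same prop_distinct[OF g(1)] by (simp add: same)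
      show "\<forall>X\<in>mso_free_sets \<phi>. labeled_nodes T L' (set_prop g X) = V X"
        using MExNode.prems(5) same prop_distinct[OF g(1)] by simp
    qed (use MExNode.prems(1) L' in auto)
    then show "hqctl_sat (insert ?q AP) (T\<lparr>label := L'\<rparr>) Map.empty None 0
        (HAnd (HSingleton (aux_prop g) ?q) (to_hqctl g \<phi>)) \<longleftrightarrow>
        (\<exists>s. labeled_nodes T L' ?q = {s} \<and> mso_sat T (v(x := s)) V \<phi>)"
      using sat_HSingleton[OF tree covered prop_distinct(1)[OF g(1)] L']
      by (auto simp only: hqctl_sat.simps(2,3))
  qed
  then show ?case by auto
next
  case (MExSet X \<phi>)
  let ?q = "set_prop g X"
  have "hqctl_sat AP (T\<lparr>label := L\<rparr>) Map.empty None 0 (to_hqctl g (MExSet X \<phi>)) \<longleftrightarrow>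
      (\<exists>A\<subseteq>nodes T. mso_sat T v (V(X := A)) \<phi>)"
    unfolding to_hqctl.simps
  proof (rule hqctl_sat_HExProp_iff[OF MExSet.prems(2)])
    fix L' assume L': "\<forall>s\<in>nodes T. L' s \<subseteq> insert ?q AP"
      and agree: "\<forall>s\<in>nodes T. \<forall>a. a \<noteq> ?q \<longrightarrow> (a \<in> L' s \<longleftrightarrow> a \<in> L s)"
    have fresh: "?q \<notin> F" using g(2) by (auto simp: set_prop_def)
    have same: "labeled_nodes T L' a = labeled_nodes T L a" if "a \<noteq> ?q" for a
      using agree that by auto
    show "hqctl_sat (insert ?q AP) (T\<lparr>label := L'\<rparr>) Map.empty None 0 (to_hqctl g \<phi>) \<longleftrightarrow>
        mso_sat T v (V(X := labeled_nodes T L' ?q)) \<phi>"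
    proof (rule MExSet.IH)
      show "\<forall>s\<in>nodes T. \<forall>a\<in>F. a \<in> L' s \<longleftrightarrow> a \<in> label T s"
        using MExSet.prems(3) agree fresh by metis
      show "\<forall>y\<in>mso_free_nodes \<phi>. labeled_nodes T L' (node_prop g y) = {v y}"
        using MExSet.prems(4) same prop_distinct[OF g(1)] by simp
      show "\<forall>Y\<in>mso_free_sets \<phi>.
          labeled_nodes T L' (set_prop g Y) = (V(X := labeled_nodes T L' ?q)) Y"
        using MExSet.prems(5) same prop_distinct[OF g(1)] by simp
    qed (use MExSet.prems(1) L' in auto)
  qed
  then show ?case by simp
qed

lemma mso_to_hqctl:
  fixes \<psi> :: "'p mso"
  assumes "infinite (UNIV :: 'p set)" "mso_sentence_over AP \<psi>"
  shows "\<exists>\<phi>. hqctl_formula_over AP \<phi> \<and>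
    (\<forall>T :: ('s, 'p) ltree. labeled_tree AP T \<and> covered_by_paths T \<longrightarrow>
      (mso_models T \<psi> \<longleftrightarrow> hqctl_models AP T \<phi>))"
proof -
  have "infinite (- mso_props \<psi>)"
    using assms(1) finite_mso_props by (metis finite_compl double_complement)
  \<comment> \<open>\<open>g\<close> avoids the propositions of \<open>\<psi>\<close> but may hit
    \<open>AP\<close>, which can be the whole type. This is harmless: in the translated sentence
    every encoding proposition is quantified before it is read.\<close>
  then obtain g :: "nat \<Rightarrow> 'p" where g: "inj g" "range g \<inter> mso_props \<psi> = {}"
    by (metis infinite_countable_subset disjoint_eq_subset_Compl)
  have free: "mso_free_nodes \<psi> = {}" "mso_free_sets \<psi> = {}" "mso_props \<psi> \<subseteq> AP"
    using assms(2) by (auto simp: mso_sentence_over_def)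
  then have "hqctl_formula_over AP (to_hqctl g \<psi>)"
    using to_hqctl_free_paths[of g \<psi>] to_hqctl_free_props[of g \<psi>]
    by (auto simp: hqctl_formula_over_def)
  moreover have "mso_models T \<psi> \<longleftrightarrow> hqctl_models AP T (to_hqctl g \<psi>)"
    if T: "labeled_tree AP T" "covered_by_paths T" for T :: "('s, 'p) ltree"
  proof -
    have tree: "is_tree T" and lab: "\<forall>s\<in>nodes T. label T s \<subseteq> AP"
      using T by (auto simp: labeled_tree_def)
    \<comment> \<open>A sentence has no free variables, so the marking conditions hold vacuously for
      every valuation.\<close>
    have "mso_sat T v V \<psi> \<longleftrightarrow> hqctl_models AP T (to_hqctl g \<psi>)" for v V
      using to_hqctl_correct[OF tree T(2) g subset_refl lab, of v V] free
      by (simp add: hqctl_models_def)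
    then show ?thesis using mso_models_iff[OF tree] by blast
  qed
  ultimately show ?thesis by blast
qed

theorem theorem5:
  fixes AP :: "'p set"
  assumes infinite_props: "infinite (UNIV :: 'p set)"
  shows "(\<forall>\<phi> :: 'p hqctl. hqctl_formula_over AP \<phi> \<longrightarrow>
            (\<exists>\<psi> :: 'p mso. mso_sentence_over AP \<psi> \<and>
               (\<forall>T :: ('s, 'p) ltree. labeled_tree AP T \<longrightarrow>
                  (hqctl_models AP T \<phi> \<longleftrightarrow> mso_models T \<psi>)))) \<and>
         (\<forall>\<psi> :: 'p mso. mso_sentence_over AP \<psi> \<longrightarrow>
            (\<exists>\<phi> :: 'p hqctl. hqctl_formula_over AP \<phi> \<and>
               (\<forall>T :: ('s, 'p) ltree. labeled_tree AP T \<and> covered_by_paths T \<longrightarrow>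
                  (mso_models T \<psi> \<longleftrightarrow> hqctl_models AP T \<phi>))))"
  using hqctl_to_mso mso_to_hqctl[OF infinite_props] by blast

end
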